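(* Let $h_0,h_1\in UC_b(\mathsf X)$ and $\alpha>0$. Suppose that $\overline f:\mathsf X\to\mathbb R$ is bounded and upper semicontinuous and is a viscosity sub-solution of $(I-\alpha H_0)\overline f\le h_0$, and that $\underline f:\mathsf X\to\mathbb R$ is bounded and lower semicontinuous and is a viscosity super-solution of $(I-\alpha H_1)\underline f\ge h_1$. Then $$\sup_{\mathsf X}(\overline f-\underline f)\le\sup_{\mathsf X}(h_0-h_1).$$
   Context: Space. $\mathcal O=\mathbb R/\mathbb Z$ is the circle of length one. $\mathsf X=\mathcal P(\mathcal O)$ is the set of Borel probability measures on $\mathcal O$. For a distribution $m$ on $\mathcal O$, $\|m\|_{-1}=\sup\{\langle m,\varphi\rangle:\varphi\in C^\infty(\mathcal O),\int_{\mathcal O}|\partial_x\varphi|^2dx\le1\}$. $\mathsf X$ carries the metric $\mathsf d(\rho,\gamma)=\|\rho-\gamma\|_{-1}$, which makes it a compact metric space whose topology is that of weak convergence of probability measures. $UC_b(\mathsf X)$ is the set of bounded uniformly continuous real functions on $(\mathsf X,\mathsf d)$; semicontinuity is with respect to $\mathsf d$. Entropy. $S(\rho)=\int_{\mathcal O}\rho(x)\log\rho(x)\,dx$ if $\rho(dx)=\rho(x)dx$ (with $0\log0=0$), and $S(\rho)=+\infty$ otherwise. $S$ takes values in $[0,+\infty]$. Operators. $H_0$ has domain $D(H_0)$ consisting of all functions $f_0(\rho)=\frac k2\mathsf d^2(\rho,\gamma)$ on $\mathsf X$, where $k>0$ and $\gamma\in\mathsf X$ satisfies $S(\gamma)<\infty$,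 and $$H_0f_0(\rho)=\tfrac k2\big(S(\gamma)-S(\rho)\big)+\tfrac{k^2}{2}\|\rho-\gamma\|_{-1}^2\in\mathbb R\cup\{-\infty\}.$$ $H_1$ has domain $D(H_1)$ consisting of all functions $f_1(\gamma)=-\frac k2\mathsf d^2(\rho,\gamma)$ on $\mathsf X$, where $k>0$ and $\rho\in\mathsf X$ satisfies $S(\rho)<\infty$, and $$H_1f_1(\gamma)=\tfrac k2\big(S(\gamma)-S(\rho)\big)+\tfrac{k^2}{2}\|\rho-\gamma\|_{-1}^2\in\mathbb R\cup\{+\infty\}.$$ Viscosity solutions. $\overline f:\mathsf X\to\mathbb R$ is a viscosity sub-solution of $(I-\alpha H_0)\overline f\le h_0$ if for every $f_0\in D(H_0)$ there exists $\rho_0\in\mathsf X$ with $(\overline f-f_0)(\rho_0)=\sup_{\mathsf X}(\overline f-f_0)$ and $\alpha^{-1}(\overline f(\rho_0)-h_0(\rho_0))\le H_0f_0(\rho_0)$. $\underline f:\mathsf X\to\mathbb R$ is a viscosity super-solution of $(I-\alpha H_1)\underline f\ge h_1$ if for every $f_1\in D(H_1)$ there exists $\gamma_0\in\mathsf X$ with $(f_1-\underline f)(\gamma_0)=\sup_{\mathsf X}(f_1-\underline f)$ and $\alpha^{-1}(\underline f(\gamma_0)-h_1(\gamma_0))\ge H_1f_1(\gamma_0)$. *)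

theory Defs
  imports "HOL-Probability.Probability"
begin

section \<open>The circle of length one\<close>

quotient_type circle = real / "\<lambda>x y. x - y \<in> \<int>"
proof (rule equivpI)
  show "reflp (\<lambda>x y :: real. x - y \<in> \<int>)"
    by (simp add: reflp_def)
  show "symp (\<lambda>x y :: real. x - y \<in> \<int>)"
    by (intro sympI) (metis Ints_minus minus_diff_eq)
  show "transp (\<lambda>x y :: real. x - y \<in> \<int>)"
    by (intro transpI) (metis Ints_add diff_add_cancel add_diff_eq)
qed

text \<open>The quotient topology, so that \<open>borel :: circle measure\<close> is the usual Borel sigma-algebra.\<close>

instantiation circle :: topological_space
begin

definition open_circle :: "circle set \<Rightarrow> bool" where
  "open_circle U \<longleftrightarrow> open (abs_circle -` U)"

instance
  by standard (auto simp: open_circle_def vimage_Int vimage_Union)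

end

lemma abs_circle_eq_iff: "abs_circle x = abs_circle y \<longleftrightarrow> x - y \<in> \<int>"
  using circle.abs_eq_iff by blast

lemma continuous_on_abs_circle: "continuous_on UNIV abs_circle"
  by (simp add: continuous_on_open_vimage open_circle_def)

lemma abs_circle_measurable [measurable]: "abs_circle \<in> borel_measurable borel"
  by (rule borel_measurable_continuous_onI) (rule continuous_on_abs_circle)

lemma abs_rep_circle: "abs_circle (rep_circle p) = p"
  by (rule Quotient3_abs_rep[OF Quotient3_circle])

definition circle_lebesgue :: "circle measure" where
  "circle_lebesgue = distr (restrict_space lborel {0..<1}) borel abs_circle"

text \<open>A function on the circle is smooth, and is differentiated, via its 1-periodic lift to the line.
  The derivative does not depend on the representative chosen by \<^term>\<open>rep_circle\<close>, see
  \<open>circle_deriv_abs\<close> below.\<close>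

definition smooth_circle :: "(circle \<Rightarrow> real) \<Rightarrow> bool" where
  "smooth_circle \<phi> \<longleftrightarrow> (\<forall>n x. (deriv ^^ n) (\<phi> \<circ> abs_circle) field_differentiable (at x))"

definition circle_deriv :: "(circle \<Rightarrow> real) \<Rightarrow> circle \<Rightarrow> real" where
  "circle_deriv \<phi> p = deriv (\<phi> \<circ> abs_circle) (rep_circle p)"

lemma circle_deriv_abs: "circle_deriv \<phi> (abs_circle x) = deriv (\<phi> \<circ> abs_circle) x"
proof -
  define g where "g = \<phi> \<circ> abs_circle"
  define c where "c = rep_circle (abs_circle x) - x"
  have "abs_circle (rep_circle (abs_circle x)) = abs_circle x"
    by (rule abs_rep_circle)
  then have c: "c \<in> \<int>"
    by (simp add: abs_circle_eq_iff c_def)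
  have per: "g (y + c) = g y" for y
    using c by (auto simp: g_def abs_circle_eq_iff intro!: arg_cong[of _ _ \<phi>])
  have "(g has_field_derivative D) (at (x + c)) \<longleftrightarrow> (g has_field_derivative D) (at x)" for D
    using DERIV_shift[of g D x c] by (simp add: per)
  then have "deriv g (x + c) = deriv g x"
    by (simp add: deriv_def)
  then show ?thesis
    by (simp add: circle_deriv_def g_def c_def)
qed

section \<open>Probability measures, the negative Sobolev norm and the entropy\<close>

definition PX :: "circle measure set" where
  "PX = {\<rho>. prob_space \<rho> \<and> sets \<rho> = sets borel}"

text \<open>A distribution is given by its pairing \<open>\<phi> \<mapsto> \<langle>m, \<phi>\<rangle>\<close> with test functions.
  The supremum is taken in \<^typ>\<open>ereal\<close>, as it may be infinite for a general distribution.\<close>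

definition hm1_norm :: "((circle \<Rightarrow> real) \<Rightarrow> real) \<Rightarrow> ereal" where
  "hm1_norm m =
    (SUP \<phi> \<in> {\<phi>. smooth_circle \<phi> \<and> (LINT x|circle_lebesgue. (circle_deriv \<phi> x)\<^sup>2) \<le> 1}. ereal (m \<phi>))"

definition measure_diff :: "circle measure \<Rightarrow> circle measure \<Rightarrow> (circle \<Rightarrow> real) \<Rightarrow> real" where
  "measure_diff \<rho> \<gamma> \<phi> = (LINT x|\<rho>. \<phi> x) - (LINT x|\<gamma>. \<phi> x)"

text \<open>The norm below is finite, see \<open>ereal_dX\<close>.\<close>

definition dX :: "circle measure \<Rightarrow> circle measure \<Rightarrow> real" where
  "dX \<rho> \<gamma> = real_of_ereal (hm1_norm (measure_diff \<rho> \<gamma>))"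

text \<open>Since \<open>r log r\<close> is bounded below, the second integral is always finite for \<open>\<rho> \<in> PX\<close>;
  the first one may be infinite. Note \<open>0 * ln 0 = 0\<close>, and that \<^const>\<open>ennreal\<close> truncates
  negative numbers to 0.\<close>

definition entropy_S :: "circle measure \<Rightarrow> ereal" where
  "entropy_S \<rho> =
    (if absolutely_continuous circle_lebesgue \<rho> then
       (let r = (\<lambda>x. enn2real (RN_deriv circle_lebesgue \<rho> x)) in
          enn2ereal (\<integral>\<^sup>+x. ennreal (r x * ln (r x)) \<partial>circle_lebesgue)
        - enn2ereal (\<integral>\<^sup>+x. ennreal (- (r x * ln (r x))) \<partial>circle_lebesgue))
     else \<infinity>)"

section \<open>Functions on the space of probability measures\<close>

definition UC_b :: "(circle measure \<Rightarrow> real) set" where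
  "UC_b = {h. bounded (h ` PX) \<and>
     (\<forall>e>0. \<exists>\<delta>>0. \<forall>\<rho>\<in>PX. \<forall>\<gamma>\<in>PX. dX \<rho> \<gamma> < \<delta> \<longrightarrow> \<bar>h \<rho> - h \<gamma>\<bar> < e)}"

definition usc_X :: "(circle measure \<Rightarrow> real) \<Rightarrow> bool" where
  "usc_X f \<longleftrightarrow> (\<forall>\<rho>\<in>PX. \<forall>e>0. \<exists>\<delta>>0. \<forall>\<gamma>\<in>PX. dX \<gamma> \<rho> < \<delta> \<longrightarrow> f \<gamma> < f \<rho> + e)"

definition lsc_X :: "(circle measure \<Rightarrow> real) \<Rightarrow> bool" where
  "lsc_X f \<longleftrightarrow> (\<forall>\<rho>\<in>PX. \<forall>e>0. \<exists>\<delta>>0. \<forall>\<gamma>\<in>PX. dX \<gamma> \<rho> < \<delta> \<longrightarrow> f \<rho> - e < f \<gamma>)"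

section \<open>The operators and viscosity solutions\<close>

text \<open>The operators are given by their graphs, i.e. as sets of pairs \<open>(f, H f)\<close>. In both
  formulas one of the two entropies is finite, so the difference is never \<open>\<infinity> - \<infinity>\<close>.\<close>

type_synonym operator_graph = "((circle measure \<Rightarrow> real) \<times> (circle measure \<Rightarrow> ereal)) set"

definition H0 :: operator_graph where
  "H0 = {(\<lambda>\<rho>. k / 2 * (dX \<rho> \<gamma>)\<^sup>2,
          \<lambda>\<rho>. ereal (k / 2) * (entropy_S \<gamma> - entropy_S \<rho>) + ereal (k\<^sup>2 / 2) * (hm1_norm (measure_diff \<rho> \<gamma>))\<^sup>2)
         | k \<gamma>. k > 0 \<and> \<gamma> \<in> PX \<and> entropy_S \<gamma> < \<infinity>}"

definition H1 :: operator_graph where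
  "H1 = {(\<lambda>\<gamma>. - (k / 2) * (dX \<rho> \<gamma>)\<^sup>2,
          \<lambda>\<gamma>. ereal (k / 2) * (entropy_S \<gamma> - entropy_S \<rho>) + ereal (k\<^sup>2 / 2) * (hm1_norm (measure_diff \<rho> \<gamma>))\<^sup>2)
         | k \<rho>. k > 0 \<and> \<rho> \<in> PX \<and> entropy_S \<rho> < \<infinity>}"

definition viscosity_subsolution ::
  "operator_graph \<Rightarrow> real \<Rightarrow> (circle measure \<Rightarrow> real) \<Rightarrow> (circle measure \<Rightarrow> real) \<Rightarrow> bool" where
  "viscosity_subsolution H \<alpha> h f \<longleftrightarrow>
     (\<forall>(f0, Hf0) \<in> H. \<exists>\<rho>0\<in>PX.
        ereal (f \<rho>0 - f0 \<rho>0) = (SUP \<rho>\<in>PX. ereal (f \<rho> - f0 \<rho>)) \<and>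
        ereal (inverse \<alpha> * (f \<rho>0 - h \<rho>0)) \<le> Hf0 \<rho>0)"

definition viscosity_supersolution ::
  "operator_graph \<Rightarrow> real \<Rightarrow> (circle measure \<Rightarrow> real) \<Rightarrow> (circle measure \<Rightarrow> real) \<Rightarrow> bool" where
  "viscosity_supersolution H \<alpha> h f \<longleftrightarrow>
     (\<forall>(f1, Hf1) \<in> H. \<exists>\<gamma>0\<in>PX.
        ereal (f1 \<gamma>0 - f \<gamma>0) = (SUP \<gamma>\<in>PX. ereal (f1 \<gamma> - f \<gamma>)) \<and>
        ereal (inverse \<alpha> * (f \<gamma>0 - h \<gamma>0)) \<ge> Hf1 \<gamma>0)"

section \<open>Finiteness of the metric\<close>

lemma smooth_circle_deriv:
  assumes "smooth_circle \<phi>"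
  shows "((\<phi> \<circ> abs_circle) has_real_derivative deriv (\<phi> \<circ> abs_circle) x) (at x)"
    and "continuous_on A (deriv (\<phi> \<circ> abs_circle))"
proof -
  have "(deriv ^^ 0) (\<phi> \<circ> abs_circle) field_differentiable (at x)"
    using assms unfolding smooth_circle_def by blast
  then show "((\<phi> \<circ> abs_circle) has_real_derivative deriv (\<phi> \<circ> abs_circle) x) (at x)"
    by (simp add: DERIV_deriv_iff_field_differentiable)
  have "(deriv ^^ 1) (\<phi> \<circ> abs_circle) field_differentiable (at y)" for y
    using assms unfolding smooth_circle_def by blast
  then show "continuous_on A (deriv (\<phi> \<circ> abs_circle))"
    by (intro continuous_at_imp_continuous_on ballI field_differentiable_imp_continuous_at) simp
qed

lemma smooth_circle_continuous:
  assumes "smooth_circle \<phi>"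
  shows "continuous_on UNIV \<phi>"
proof -
  have g: "continuous_on UNIV (\<phi> \<circ> abs_circle)"
    using smooth_circle_deriv(1)[OF assms] by (meson DERIV_continuous_on has_field_derivative_at_within)
  show ?thesis
    unfolding continuous_on_open_vimage[OF open_UNIV]
  proof (intro allI impI)
    fix B :: "real set" assume "open B"
    then have "open ((\<phi> \<circ> abs_circle) -` B)"
      using g by (simp only: continuous_on_open_vimage[OF open_UNIV] Int_UNIV_right)
    then show "open (\<phi> -` B \<inter> UNIV)"
      by (simp add: open_circle_def vimage_comp)
  qed
qed

lemma circle_rep01: obtains x where "0 \<le> x" "x < 1" "p = abs_circle x"
proof -
  have "abs_circle (frac (rep_circle p)) = abs_circle (rep_circle p)"
    by (simp add: abs_circle_eq_iff frac_def)
  then show ?thesis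
    using that[of "frac (rep_circle p)"] by (simp add: abs_rep_circle frac_lt_1)
qed

lemma smooth_circle_energy:
  assumes "smooth_circle \<phi>"
  shows "(LINT x|circle_lebesgue. (circle_deriv \<phi> x)\<^sup>2) = integral {0..1} (\<lambda>x. (deriv (\<phi> \<circ> abs_circle) x)\<^sup>2)"
proof -
  define g where "g = \<phi> \<circ> abs_circle"
  have cont: "continuous_on A (\<lambda>x. (deriv g x)\<^sup>2)" for A
    unfolding g_def by (intro continuous_intros smooth_circle_deriv(2) assms)
  have "continuous_on UNIV (circle_deriv \<phi>)"
    unfolding continuous_on_open_vimage[OF open_UNIV]
  proof (intro allI impI)
    fix B :: "real set" assume "open B"
    moreover have "circle_deriv \<phi> \<circ> abs_circle = deriv g"
      by (auto simp: circle_deriv_abs g_def)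
    ultimately have "open ((circle_deriv \<phi> \<circ> abs_circle) -` B)"
      using smooth_circle_deriv(2)[OF assms, of UNIV] by (simp add: continuous_on_open_vimage g_def)
    then show "open (circle_deriv \<phi> -` B \<inter> UNIV)"
      by (simp add: open_circle_def vimage_comp)
  qed
  then have [measurable]: "circle_deriv \<phi> \<in> borel_measurable borel"
    by (rule borel_measurable_continuous_onI)
  have [measurable]: "abs_circle \<in> measurable (restrict_space lborel {0..<1}) borel"
    by (intro measurable_restrict_space1) simp
  have "(LINT x|circle_lebesgue. (circle_deriv \<phi> x)\<^sup>2)
      = (LINT x|restrict_space lborel {0..<1}. (deriv g x)\<^sup>2)"
    unfolding circle_lebesgue_def by (subst integral_distr) (auto simp: circle_deriv_abs g_def)
  also have "\<dots> = (LINT x:{0..<1}|lborel. (deriv g x)\<^sup>2)"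
    by (subst integral_restrict_space) (auto simp: set_lebesgue_integral_def)
  also have "\<dots> = integral {0..<1} (\<lambda>x. (deriv g x)\<^sup>2)"
    by (intro set_borel_integral_eq_integral set_integrable_subset[OF borel_integrable_atLeastAtMost'[OF cont, of 0 1]])
       auto
  also have "\<dots> = integral {0..1} (\<lambda>x. (deriv g x)\<^sup>2)"
  proof (rule integral_spike_set)
    show "negligible {x \<in> {0..<1} - {0..1}. (deriv g x)\<^sup>2 \<noteq> 0}"
      by (rule negligible_subset[of "{}"]) auto
    show "negligible {x \<in> {0..1} - {0..<1}. (deriv g x)\<^sup>2 \<noteq> 0}"
      by (rule negligible_subset[of "{1}"]) auto
  qed
  finally show ?thesis
    by (simp add: g_def)
qed

lemma smooth_circle_oscillation:
  assumes "smooth_circle \<phi>" "(LINT x|circle_lebesgue. (circle_deriv \<phi> x)\<^sup>2) \<le> 1"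
  shows "\<bar>\<phi> p - \<phi> (abs_circle 0)\<bar> \<le> 1"
proof -
  define g where "g = \<phi> \<circ> abs_circle"
  obtain x where x: "0 \<le> x" "x < 1" "p = abs_circle x"
    by (rule circle_rep01)
  have cont: "continuous_on A (deriv g)" for A
    unfolding g_def by (rule smooth_circle_deriv(2)[OF assms(1)])
  have en: "integral {0..1} (\<lambda>t. (deriv g t)\<^sup>2) \<le> 1"
    using assms(2) smooth_circle_energy[OF assms(1)] by (simp add: g_def)
  have "(deriv g has_integral (g x - g 0)) {0..x}"
    using smooth_circle_deriv(1)[OF assms(1)] x(1) unfolding g_def
    by (intro fundamental_theorem_of_calculus)
       (auto simp flip: has_real_derivative_iff_has_vector_derivative simp del: o_apply
             intro: has_field_derivative_at_within)
  then have "\<bar>g x - g 0\<bar> = norm (integral {0..x} (deriv g))"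
    by (simp add: integral_unique)
  also have "\<dots> \<le> integral {0..x} (\<lambda>t. (1 + (deriv g t)\<^sup>2) / 2)"
  proof (rule integral_norm_bound_integral)
    show "norm (deriv g t) \<le> (1 + (deriv g t)\<^sup>2) / 2" for t
      using zero_le_power2[of "\<bar>deriv g t\<bar> - 1"] by (simp add: power2_diff)
  qed (intro integrable_continuous_real continuous_intros cont; simp)+
  also have "\<dots> \<le> integral {0..1} (\<lambda>t. (1 + (deriv g t)\<^sup>2) / 2)"
    using x by (intro integral_subset_le integrable_continuous_real continuous_intros cont)
       (auto intro: add_nonneg_nonneg)
  also have "\<dots> = (1 + integral {0..1} (\<lambda>t. (deriv g t)\<^sup>2)) / 2"
    by (subst integral_divide, subst integral_add)
       (auto intro!: integrable_continuous_real continuous_intros cont)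
  also have "\<dots> \<le> 1"
    using en by simp
  finally show ?thesis
    by (simp add: g_def x)
qed

lemma measure_diff_bound:
  assumes "\<rho> \<in> PX" "\<gamma> \<in> PX" "smooth_circle \<phi>" "(LINT x|circle_lebesgue. (circle_deriv \<phi> x)\<^sup>2) \<le> 1"
  shows "measure_diff \<rho> \<gamma> \<phi> \<le> 2"
proof -
  define c where "c = \<phi> (abs_circle 0)"
  have *: "\<bar>(LINT x|\<mu>. \<phi> x) - c\<bar> \<le> 1" if "\<mu> \<in> PX" for \<mu>
  proof -
    interpret prob_space \<mu> using that by (simp add: PX_def)
    have [measurable_cong]: "sets \<mu> = sets borel" using that by (simp add: PX_def)
    have [measurable]: "\<phi> \<in> borel_measurable borel"
      by (intro borel_measurable_continuous_onI smooth_circle_continuous assms)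
    have osc: "\<phi> x \<le> c + 1" "c - 1 \<le> \<phi> x" for x
      using smooth_circle_oscillation[OF assms(3,4), of x] by (auto simp: c_def)
    have int: "integrable \<mu> \<phi>"
    proof (rule integrable_const_bound[where B = "\<bar>c\<bar> + 1"])
      show "AE x in \<mu>. norm (\<phi> x) \<le> \<bar>c\<bar> + 1"
        using osc by (intro always_eventually) (smt (verit) real_norm_def)
    qed measurable
    show ?thesis
      using integral_le_const[OF int, of "c + 1"] integral_ge_const[OF int, of "c - 1"] osc by auto
  qed
  show ?thesis
    using *[OF assms(1)] *[OF assms(2)] by (auto simp: measure_diff_def)
qed

lemma ereal_dX:
  assumes "\<rho> \<in> PX" "\<gamma> \<in> PX"
  shows "ereal (dX \<rho> \<gamma>) = hm1_norm (measure_diff \<rho> \<gamma>)"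
proof -
  have "hm1_norm (measure_diff \<rho> \<gamma>) \<le> ereal 2"
    unfolding hm1_norm_def using measure_diff_bound[OF assms] by (auto intro!: SUP_least)
  moreover have z: "(deriv ^^ n) (\<lambda>x::real. 0) = (\<lambda>x. 0)" for n
    by (induction n) auto
  have "0 \<le> hm1_norm (measure_diff \<rho> \<gamma>)"
    unfolding hm1_norm_def
    by (rule SUP_upper2[of "\<lambda>_. 0"])
       (auto simp: smooth_circle_def comp_def z circle_deriv_def measure_diff_def)
  ultimately show ?thesis
    unfolding dX_def by (subst ereal_real') auto
qed

end

theory Submission
  imports Defs
begin

text \<open>
  Write \<open>u\<close>, \<open>v\<close> for the sub- and the super-solution, \<open>d\<close> for the metric, \<open>S\<close> for the entropy,
  and let \<open>F\<close> be the set of measures of finite entropy. For a penalty \<open>k\<close> and \<open>\<gamma> \<in> F\<close>, the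
  sub-solution property selects a maximizer \<open>R \<gamma> \<in> F\<close> of \<open>u - k/2 d\<^sup>2(\<sqdot>, \<gamma>)\<close>; denote the
  maximal value by \<open>U \<gamma>\<close>. For \<open>\<rho> \<in> F\<close>, the super-solution property selects a minimizer
  \<open>\<gamma>' \<in> F\<close> of \<open>v + k/2 d\<^sup>2(\<rho>, \<sqdot>)\<close>. The usual doubling of variables would need one pair
  \<open>(\<rho>, \<gamma>)\<close> that is optimal in both variables and has finite entropy, and the existence of such a pair is not
  guaranteed.
  Instead the two selections are composed: \<open>\<gamma> \<mapsto> \<rho> = R \<gamma> \<mapsto> \<gamma>'\<close>. Subtracting the two viscosity
  inequalities gives
  \<open>(u \<rho> - h\<^sub>0 \<rho> - v \<gamma>' + h\<^sub>1 \<gamma>') / \<alpha> \<le> k/2 (S \<gamma> - S \<gamma>') + k\<^sup>2/2 (d\<^sup>2(\<rho>, \<gamma>) - d\<^sup>2(\<rho>, \<gamma>'))\<close>,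
  and, since \<open>U \<gamma> = u \<rho> - k/2 d\<^sup>2(\<rho>, \<gamma>)\<close> and \<open>U \<gamma>' \<ge> u \<rho> - k/2 d\<^sup>2(\<rho>, \<gamma>')\<close>, the right-hand
  side is at most \<open>E \<gamma> - E \<gamma>'\<close> with the potential \<open>E = k/2 S - k U\<close>. This potential is bounded
  below, because \<open>S\<close> is (\<open>entropy_S_ge\<close>) and \<open>U\<close> is bounded above.

  The composed step does not decrease \<open>U - v\<close>, so it maps a superlevel set of \<open>U - v\<close> in \<open>F\<close>
  into itself. At a near-minimizer \<open>\<gamma>\<close> of \<open>E\<close> on that set, \<open>E \<gamma> - E \<gamma>'\<close> is therefore as small as
  desired, which bounds \<open>u \<rho> - v \<gamma>'\<close> by \<open>h\<^sub>0 \<rho> - h\<^sub>1 \<gamma>'\<close> up to a small error; for large \<open>k\<close> the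
  points \<open>\<rho>\<close> and \<open>\<gamma>'\<close> are close, and uniform continuity of \<open>h\<^sub>1\<close> finishes the argument. This is
  \<open>comparison_by_near_minimal_potential\<close>.

  The superlevel set must be nonempty for a level close to \<open>u p - v p\<close> at a given point \<open>p\<close>, whose
  entropy may be infinite. This follows from the super-solution property with a very large
  penalty, centred at a measure of finite entropy close to \<open>p\<close>: the minimizer has finite entropy,
  is close to \<open>p\<close>, and its value of \<open>v\<close> hardly exceeds \<open>v p\<close>. The approximation of \<open>p\<close> is
  \<open>finite_entropy_dense\<close>, obtained by averaging \<open>p\<close> over short arcs.
\<close>

section \<open>The comparison argument in a metric setting\<close>

text \<open>
  Here \<open>s\<close> is the entropy on its domain \<open>F\<close>. Only a maximizer (minimizer) in \<open>F\<close> for each centre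
  in \<open>F\<close> is assumed, as given by the definition of viscosity solutions.
\<close>

lemma comparison_by_near_minimal_potential:
  fixes X F :: "'a set" and d :: "'a \<Rightarrow> 'a \<Rightarrow> real" and s u v h\<^sub>0 h\<^sub>1 :: "'a \<Rightarrow> real"
  assumes "F \<subseteq> X" and "\<alpha> > 0"
    and d_nonneg: "\<And>x y. x \<in> X \<Longrightarrow> y \<in> X \<Longrightarrow> 0 \<le> d x y"
    and d_commute: "\<And>x y. x \<in> X \<Longrightarrow> y \<in> X \<Longrightarrow> d x y = d y x"
    and d_triangle: "\<And>x y z. x \<in> X \<Longrightarrow> y \<in> X \<Longrightarrow> z \<in> X \<Longrightarrow> d x z \<le> d x y + d y z"
    and dense: "\<And>x e. x \<in> X \<Longrightarrow> e > 0 \<Longrightarrow> \<exists>y\<in>F. d x y < e"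
    and s_bound: "\<And>x. x \<in> F \<Longrightarrow> b \<le> s x"
    and u_bound: "\<And>x. x \<in> X \<Longrightarrow> \<bar>u x\<bar> \<le> B"
    and v_bound: "\<And>x. x \<in> X \<Longrightarrow> \<bar>v x\<bar> \<le> B"
    and h1_uc: "\<And>e. e > 0 \<Longrightarrow> \<exists>\<delta>>0. \<forall>x\<in>X. \<forall>y\<in>X. d x y < \<delta> \<longrightarrow> \<bar>h\<^sub>1 x - h\<^sub>1 y\<bar> < e"
    and sub: "\<And>k \<gamma>. k > 0 \<Longrightarrow> \<gamma> \<in> F \<Longrightarrow> \<exists>\<rho>\<in>F.
        (\<forall>x\<in>X. u x - k / 2 * (d x \<gamma>)\<^sup>2 \<le> u \<rho> - k / 2 * (d \<rho> \<gamma>)\<^sup>2) \<and>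
        inverse \<alpha> * (u \<rho> - h\<^sub>0 \<rho>) \<le> k / 2 * (s \<gamma> - s \<rho>) + k\<^sup>2 / 2 * (d \<rho> \<gamma>)\<^sup>2"
    and super: "\<And>k \<rho>. k > 0 \<Longrightarrow> \<rho> \<in> F \<Longrightarrow> \<exists>\<gamma>\<in>F.
        (\<forall>x\<in>X. v \<gamma> + k / 2 * (d \<rho> \<gamma>)\<^sup>2 \<le> v x + k / 2 * (d \<rho> x)\<^sup>2) \<and>
        k / 2 * (s \<gamma> - s \<rho>) + k\<^sup>2 / 2 * (d \<rho> \<gamma>)\<^sup>2 \<le> inverse \<alpha> * (v \<gamma> - h\<^sub>1 \<gamma>)"
    and C: "\<And>x. x \<in> X \<Longrightarrow> h\<^sub>0 x - h\<^sub>1 x \<le> C"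
    and p: "p \<in> X"
  shows "u p - v p \<le> C"
proof (rule field_le_epsilon)
  fix e :: real assume "e > 0"
  \<comment> \<open>Four errors of size \<open>\<epsilon>\<close>: two from the starting point, one from near-minimality of the
    potential, one from the modulus of continuity of \<open>h\<^sub>1\<close>.\<close>
  define \<epsilon> where "\<epsilon> = min 1 (e / 4)"
  have \<epsilon>: "0 < \<epsilon>" "\<epsilon> \<le> 1" "4 * \<epsilon> \<le> e"
    using \<open>e > 0\<close> by (auto simp: \<epsilon>_def)
  have B: "0 \<le> B" using u_bound[OF p] by linarith
  have FX: "x \<in> X" if "x \<in> F" for x using that assms(1) by auto
  obtain \<delta> where \<delta>: "\<delta> > 0" "\<And>x y. x \<in> X \<Longrightarrow> y \<in> X \<Longrightarrow> d x y < \<delta> \<Longrightarrow> \<bar>h\<^sub>1 x - h\<^sub>1 y\<bar> < \<epsilon>"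
    using h1_uc[OF \<epsilon>(1)] by blast
  \<comment> \<open>Makes the penalty at distance \<open>\<delta>\<close> equal to \<open>4 B + 3\<close>, larger than the oscillation of \<open>u - v\<close> plus errors.\<close>
  define k where "k = 2 * (4 * B + 3) / \<delta>\<^sup>2"
  have k: "k > 0" using B \<delta>(1) by (simp add: k_def)
  have small: "d x y < t" if "x \<in> X" "y \<in> X" "c / 2 * (d x y)\<^sup>2 < c / 2 * t\<^sup>2" "c > 0" "t > 0" for x y c t
    using that d_nonneg[of x y] by (simp add: power_less_imp_less_base)
  \<comment> \<open>A starting point in \<open>F\<close> near \<open>p\<close> at which \<open>v\<close> is almost as small as at \<open>p\<close>.\<close>
  obtain q where q: "q \<in> F" "v q \<le> v p + \<epsilon>" "k / 2 * (d p q)\<^sup>2 \<le> \<epsilon>"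
  proof -
    define t where "t = sqrt (2 * \<epsilon> / k) / 2"
    have t: "t > 0" "k / 2 * (2 * t)\<^sup>2 = \<epsilon>"
      using k \<epsilon> by (auto simp: t_def)
    \<comment> \<open>The penalty \<open>j\<close> exceeds the oscillation of \<open>v\<close> at distance \<open>t\<close>, so the minimizer lies within \<open>t\<close> of its centre.\<close>
    define j where "j = 2 * (2 * B + 2) / t\<^sup>2"
    have j: "j > 0" "j / 2 * t\<^sup>2 = 2 * B + 2" using B t by (auto simp: j_def)
    \<comment> \<open>The centre is so close to \<open>p\<close> that \<open>p\<close> itself is a competitor with negligible penalty.\<close>
    define \<eta> where "\<eta> = min t (sqrt (2 * \<epsilon> / j))"
    have "\<eta> > 0" using t j \<epsilon> by (simp add: \<eta>_def)
    have "\<eta>\<^sup>2 \<le> (sqrt (2 * \<epsilon> / j))\<^sup>2"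
      using \<open>\<eta> > 0\<close> by (intro power_mono) (auto simp: \<eta>_def)
    then have \<eta>: "j / 2 * \<eta>\<^sup>2 \<le> \<epsilon>"
      using j \<epsilon> by (simp add: field_simps)
    obtain \<rho> where \<rho>: "\<rho> \<in> F" "d p \<rho> < \<eta>" using dense[OF p \<open>\<eta> > 0\<close>] by blast
    have "(d \<rho> p)\<^sup>2 \<le> \<eta>\<^sup>2"
      using \<rho> d_nonneg[OF p FX[OF \<rho>(1)]] d_commute[OF p FX[OF \<rho>(1)]] by (intro power_mono) auto
    then have "j / 2 * (d \<rho> p)\<^sup>2 \<le> j / 2 * \<eta>\<^sup>2"
      using j by (intro mult_left_mono) auto
    with \<eta> have dp: "j / 2 * (d \<rho> p)\<^sup>2 \<le> \<epsilon>" by linarith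
    obtain q where q: "q \<in> F" "\<And>x. x \<in> X \<Longrightarrow> v q + j / 2 * (d \<rho> q)\<^sup>2 \<le> v x + j / 2 * (d \<rho> x)\<^sup>2"
      using super[OF j(1) \<rho>(1)] by blast
    have "0 \<le> j / 2 * (d \<rho> q)\<^sup>2" using j by simp
    with q(2)[OF p] dp have vq: "v q \<le> v p + \<epsilon>" by linarith
    have "j / 2 * (d \<rho> q)\<^sup>2 < j / 2 * t\<^sup>2"
      using q(2)[OF p] dp v_bound[OF p] v_bound[OF FX[OF q(1)]] \<epsilon> j(2) by linarith
    then have "d \<rho> q < t"
      using small \<rho>(1) q(1) FX j(1) t(1) by blast
    then have "d p q \<le> 2 * t"
      using d_triangle[OF p FX[OF \<rho>(1)] FX[OF q(1)]] \<rho>(2) by (simp add: \<eta>_def)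
    then have "k / 2 * (d p q)\<^sup>2 \<le> k / 2 * (2 * t)\<^sup>2"
      using k d_nonneg[OF p FX[OF q(1)]] by (intro mult_left_mono power_mono) auto
    then show thesis using that q(1) vq t(2) by simp
  qed
  obtain R where R: "\<And>\<gamma>. \<gamma> \<in> F \<Longrightarrow> R \<gamma> \<in> F"
    and R_max: "\<And>\<gamma> x. \<gamma> \<in> F \<Longrightarrow> x \<in> X \<Longrightarrow> u x - k / 2 * (d x \<gamma>)\<^sup>2 \<le> u (R \<gamma>) - k / 2 * (d (R \<gamma>) \<gamma>)\<^sup>2"
    and R_sub: "\<And>\<gamma>. \<gamma> \<in> F \<Longrightarrow> inverse \<alpha> * (u (R \<gamma>) - h\<^sub>0 (R \<gamma>))
        \<le> k / 2 * (s \<gamma> - s (R \<gamma>)) + k\<^sup>2 / 2 * (d (R \<gamma>) \<gamma>)\<^sup>2"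
  proof -
    have "\<exists>R. \<forall>\<gamma>\<in>F. R \<gamma> \<in> F \<and>
        (\<forall>x\<in>X. u x - k / 2 * (d x \<gamma>)\<^sup>2 \<le> u (R \<gamma>) - k / 2 * (d (R \<gamma>) \<gamma>)\<^sup>2) \<and>
        inverse \<alpha> * (u (R \<gamma>) - h\<^sub>0 (R \<gamma>))
          \<le> k / 2 * (s \<gamma> - s (R \<gamma>)) + k\<^sup>2 / 2 * (d (R \<gamma>) \<gamma>)\<^sup>2"
      using sub[OF k] by (intro bchoice) blast
    then show thesis using that by blast
  qed
  define U where "U \<gamma> = u (R \<gamma>) - k / 2 * (d (R \<gamma>) \<gamma>)\<^sup>2" for \<gamma>
  define E where "E \<gamma> = k / 2 * s \<gamma> - k * U \<gamma>" for \<gamma>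
  define m where "m = U q - v q"
  define A where "A = {\<gamma> \<in> F. m \<le> U \<gamma> - v \<gamma>}"
  have m: "u p - v p - 2 * \<epsilon> \<le> m"
    using R_max[OF q(1) p] q(2,3) by (simp add: m_def U_def)
  have "k / 2 * b - k * B \<le> E \<gamma>" if "\<gamma> \<in> A" for \<gamma>
  proof -
    have \<gamma>: "\<gamma> \<in> F" using that by (simp add: A_def)
    have "0 \<le> k / 2 * (d (R \<gamma>) \<gamma>)\<^sup>2" using k by simp
    then have "U \<gamma> \<le> B"
      using u_bound[OF FX[OF R[OF \<gamma>]]] unfolding U_def by linarith
    then show ?thesis
      using s_bound[OF \<gamma>] k unfolding E_def by (intro diff_mono mult_left_mono) auto
  qed
  then have bdd: "bdd_below (E ` A)" by (intro bdd_belowI2)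
  have "q \<in> A" using q(1) by (simp add: A_def m_def)
  then have "E ` A \<noteq> {}" by blast
  then obtain \<gamma> where \<gamma>: "\<gamma> \<in> A" "E \<gamma> < Inf (E ` A) + \<epsilon> / \<alpha>"
    using cInf_lessD[of "E ` A" "Inf (E ` A) + \<epsilon> / \<alpha>"] \<epsilon>(1) \<open>\<alpha> > 0\<close> by auto
  define \<rho> where "\<rho> = R \<gamma>"
  have \<gamma>F: "\<gamma> \<in> F" using \<gamma> by (simp add: A_def)
  then have \<rho>F: "\<rho> \<in> F" using R by (simp add: \<rho>_def)
  obtain \<gamma>' where \<gamma>': "\<gamma>' \<in> F"
    and min': "\<And>x. x \<in> X \<Longrightarrow> v \<gamma>' + k / 2 * (d \<rho> \<gamma>')\<^sup>2 \<le> v x + k / 2 * (d \<rho> x)\<^sup>2"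
    and super': "k / 2 * (s \<gamma>' - s \<rho>) + k\<^sup>2 / 2 * (d \<rho> \<gamma>')\<^sup>2 \<le> inverse \<alpha> * (v \<gamma>' - h\<^sub>1 \<gamma>')"
    using super[OF k \<rho>F] by blast
  have U_\<gamma>: "U \<gamma> = u \<rho> - k / 2 * (d \<rho> \<gamma>)\<^sup>2" by (simp add: U_def \<rho>_def)
  have U_\<gamma>': "u \<rho> - k / 2 * (d \<rho> \<gamma>')\<^sup>2 \<le> U \<gamma>'"
    using R_max[OF \<gamma>' FX[OF \<rho>F]] by (simp add: U_def)
  have gap: "m \<le> u \<rho> - v \<gamma>' - k / 2 * (d \<rho> \<gamma>')\<^sup>2"
    using min'[OF FX[OF \<gamma>F]] U_\<gamma> \<gamma>(1) by (simp add: A_def)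
  then have "\<gamma>' \<in> A" using U_\<gamma>' \<gamma>' by (simp add: A_def)
  then have "E \<gamma> < E \<gamma>' + \<epsilon> / \<alpha>"
    using cInf_lower[OF _ bdd, of "E \<gamma>'"] \<gamma>(2) by fastforce
  moreover have "inverse \<alpha> * (u \<rho> - h\<^sub>0 \<rho>) - inverse \<alpha> * (v \<gamma>' - h\<^sub>1 \<gamma>') \<le> E \<gamma> - E \<gamma>'"
  proof -
    have "k * (k / 2 * (d \<rho> \<gamma>)\<^sup>2 - k / 2 * (d \<rho> \<gamma>')\<^sup>2) \<le> k * (U \<gamma>' - U \<gamma>)"
      using U_\<gamma> U_\<gamma>' k by (intro mult_left_mono) auto
    then show ?thesis
      using R_sub[OF \<gamma>F] super' unfolding \<rho>_def[symmetric] E_def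
      by (simp add: algebra_simps power2_eq_square diff_divide_distrib)
  qed
  ultimately have "inverse \<alpha> * (u \<rho> - h\<^sub>0 \<rho> - (v \<gamma>' - h\<^sub>1 \<gamma>')) < \<epsilon> / \<alpha>"
    by (simp add: right_diff_distrib)
  then have main: "u \<rho> - v \<gamma>' < h\<^sub>0 \<rho> - h\<^sub>1 \<gamma>' + \<epsilon>"
    using \<open>\<alpha> > 0\<close> by (simp add: inverse_eq_divide divide_less_cancel)
  have "k / 2 * \<delta>\<^sup>2 = 4 * B + 3" using \<delta>(1) by (simp add: k_def)
  then have "k / 2 * (d \<rho> \<gamma>')\<^sup>2 < k / 2 * \<delta>\<^sup>2"
    using gap m \<epsilon>(2) u_bound[OF p] v_bound[OF p] u_bound[OF FX[OF \<rho>F]] v_bound[OF FX[OF \<gamma>']]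
    by linarith
  then have "d \<rho> \<gamma>' < \<delta>"
    using small \<rho>F \<gamma>' FX k \<delta>(1) by blast
  then have "\<bar>h\<^sub>1 \<rho> - h\<^sub>1 \<gamma>'\<bar> < \<epsilon>" using \<delta>(2) FX \<rho>F \<gamma>' by blast
  moreover have "0 \<le> k / 2 * (d \<rho> \<gamma>')\<^sup>2" using k by simp
  ultimately show "u p - v p \<le> C + e"
    using main gap m \<epsilon>(3) C[OF FX[OF \<rho>F]] by linarith
qed

section \<open>Metric properties of the negative Sobolev distance\<close>

lemma admissible_uminus:
  assumes "smooth_circle \<phi>" "(LINT x|circle_lebesgue. (circle_deriv \<phi> x)\<^sup>2) \<le> 1"
  shows "smooth_circle (\<lambda>x. - \<phi> x)" "(LINT x|circle_lebesgue. (circle_deriv (\<lambda>x. - \<phi> x) x)\<^sup>2) \<le> 1"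
proof -
  have iter: "(deriv ^^ n) (\<lambda>x. - (\<phi> \<circ> abs_circle) x) = (\<lambda>x. - (deriv ^^ n) (\<phi> \<circ> abs_circle) x)" for n
  proof (induction n)
    case (Suc n)
    have "deriv (\<lambda>x. - (deriv ^^ n) (\<phi> \<circ> abs_circle) x) x = - deriv ((deriv ^^ n) (\<phi> \<circ> abs_circle)) x" for x
      using assms(1) by (intro deriv_minus) (simp add: smooth_circle_def)
    then show ?case by (simp only: funpow.simps(2) o_apply[of deriv] Suc)
  qed simp
  have comp: "(\<lambda>x. - \<phi> x) \<circ> abs_circle = (\<lambda>x. - (\<phi> \<circ> abs_circle) x)" by auto
  show "smooth_circle (\<lambda>x. - \<phi> x)"
    using assms(1) unfolding smooth_circle_def comp iter by (auto intro!: derivative_intros)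
  have "circle_deriv (\<lambda>x. - \<phi> x) x = - circle_deriv \<phi> x" for x
    using iter[of 1] unfolding circle_deriv_def comp by simp
  then show "(LINT x|circle_lebesgue. (circle_deriv (\<lambda>x. - \<phi> x) x)\<^sup>2) \<le> 1"
    using assms(2) by simp
qed

lemma measure_diff_le_dX:
  assumes "\<rho> \<in> PX" "\<gamma> \<in> PX" "smooth_circle \<phi>" "(LINT x|circle_lebesgue. (circle_deriv \<phi> x)\<^sup>2) \<le> 1"
  shows "measure_diff \<rho> \<gamma> \<phi> \<le> dX \<rho> \<gamma>"
proof -
  have "ereal (measure_diff \<rho> \<gamma> \<phi>) \<le> ereal (dX \<rho> \<gamma>)"
    unfolding ereal_dX[OF assms(1,2)] hm1_norm_def using assms(3,4) by (intro SUP_upper) auto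
  then show ?thesis by simp
qed

lemma dX_leI:
  assumes "\<rho> \<in> PX" "\<gamma> \<in> PX"
    and "\<And>\<phi>. smooth_circle \<phi> \<Longrightarrow> (LINT x|circle_lebesgue. (circle_deriv \<phi> x)\<^sup>2) \<le> 1 \<Longrightarrow> measure_diff \<rho> \<gamma> \<phi> \<le> c"
  shows "dX \<rho> \<gamma> \<le> c"
proof -
  have "ereal (dX \<rho> \<gamma>) \<le> ereal c"
    unfolding ereal_dX[OF assms(1,2)] hm1_norm_def using assms(3) by (intro SUP_least) auto
  then show ?thesis by simp
qed

lemma dX_commute:
  assumes "\<rho> \<in> PX" "\<gamma> \<in> PX"
  shows "dX \<rho> \<gamma> = dX \<gamma> \<rho>"
proof -
  have "dX \<mu> \<nu> \<le> dX \<nu> \<mu>" if "\<mu> \<in> PX" "\<nu> \<in> PX" for \<mu> \<nu>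
  proof (rule dX_leI[OF that])
    fix \<phi> assume \<phi>: "smooth_circle \<phi>" "(LINT x|circle_lebesgue. (circle_deriv \<phi> x)\<^sup>2) \<le> 1"
    show "measure_diff \<mu> \<nu> \<phi> \<le> dX \<nu> \<mu>"
      using measure_diff_le_dX[OF that(2,1) admissible_uminus[OF \<phi>]] by (simp add: measure_diff_def)
  qed
  then show ?thesis using assms by (meson order_antisym)
qed

lemma dX_triangle:
  assumes "\<rho> \<in> PX" "\<gamma> \<in> PX" "\<mu> \<in> PX"
  shows "dX \<rho> \<mu> \<le> dX \<rho> \<gamma> + dX \<gamma> \<mu>"
proof (rule dX_leI[OF assms(1,3)])
  fix \<phi> assume \<phi>: "smooth_circle \<phi>" "(LINT x|circle_lebesgue. (circle_deriv \<phi> x)\<^sup>2) \<le> 1"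
  show "measure_diff \<rho> \<mu> \<phi> \<le> dX \<rho> \<gamma> + dX \<gamma> \<mu>"
    using measure_diff_le_dX[OF assms(1,2) \<phi>] measure_diff_le_dX[OF assms(2,3) \<phi>]
    by (simp add: measure_diff_def)
qed

lemma dX_self: "dX \<rho> \<rho> = 0" if "\<rho> \<in> PX"
proof -
  have "dX \<rho> \<rho> \<le> 0" by (rule dX_leI[OF that that]) (simp add: measure_diff_def)
  moreover have "dX \<rho> \<rho> \<le> dX \<rho> \<rho> + dX \<rho> \<rho>" by (intro dX_triangle that)
  ultimately show ?thesis by linarith
qed

lemma dX_nonneg:
  assumes "\<rho> \<in> PX" "\<gamma> \<in> PX"
  shows "0 \<le> dX \<rho> \<gamma>"
  using dX_triangle[OF assms(1,2,1)] dX_commute[OF assms] dX_self[OF assms(1)] by linarith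

section \<open>Bounds on the entropy\<close>

lemma sets_circle_lebesgue [measurable_cong, simp]: "sets circle_lebesgue = sets borel"
  by (simp add: circle_lebesgue_def)

lemma space_circle_lebesgue [simp]: "space circle_lebesgue = UNIV"
  by (simp add: circle_lebesgue_def)

lemma abs_circle_measurable_restrict [measurable]:
  "abs_circle \<in> measurable (restrict_space lborel {0..<1}) borel"
  by (intro measurable_restrict_space1) simp

lemma emeasure_circle_lebesgue:
  assumes "A \<in> sets borel"
  shows "emeasure circle_lebesgue A = emeasure lborel (abs_circle -` A \<inter> {0..<1})"
  unfolding circle_lebesgue_def using assms
  by (subst emeasure_distr) (auto simp: emeasure_restrict_space space_restrict_space)

interpretation circle_lebesgue: prob_space circle_lebesgue
  by standard (simp add: emeasure_circle_lebesgue)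

text \<open>The sharp bound is \<open>0\<close>, by Jensen's inequality; the pointwise estimate \<open>- r ln r \<le> 1\<close>
  is enough to bound the potential from below.\<close>

lemma entropy_S_ge: "- 1 \<le> entropy_S \<rho>"
proof (cases "absolutely_continuous circle_lebesgue \<rho>")
  case True
  define r where "r x = enn2real (RN_deriv circle_lebesgue \<rho> x)" for x
  have "- (r x * ln (r x)) \<le> 1" for x
  proof (cases "r x = 0")
    case False
    then have r: "r x > 0" by (simp add: r_def less_le)
    have "ln (inverse (r x)) \<le> inverse (r x) - 1"
      using r by (intro ln_le_minus_one) simp
    then have "r x * ln (inverse (r x)) \<le> r x * (inverse (r x) - 1)"
      using r by (intro mult_left_mono) auto
    then have "- (r x * ln (r x)) \<le> 1 - r x"
      using r by (simp add: ln_inverse right_diff_distrib)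
    then show ?thesis using r by simp
  qed simp
  then have "(\<integral>\<^sup>+x. ennreal (- (r x * ln (r x))) \<partial>circle_lebesgue) \<le> (\<integral>\<^sup>+x. 1 \<partial>circle_lebesgue)"
    by (intro nn_integral_mono) (simp add: ennreal_le_1)
  also have "\<dots> = 1"
    using circle_lebesgue.emeasure_space_1 by simp
  finally have "enn2ereal (\<integral>\<^sup>+x. ennreal (- (r x * ln (r x))) \<partial>circle_lebesgue) \<le> 1"
    by (metis less_eq_ennreal.rep_eq one_ennreal.rep_eq)
  then have "0 - 1 \<le> enn2ereal (\<integral>\<^sup>+x. ennreal (r x * ln (r x)) \<partial>circle_lebesgue)
      - enn2ereal (\<integral>\<^sup>+x. ennreal (- (r x * ln (r x))) \<partial>circle_lebesgue)"
    by (intro ereal_minus_mono) auto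
  then show ?thesis
    using True by (simp add: entropy_S_def r_def)
qed (simp add: entropy_S_def)

text \<open>A density bounded by \<open>c\<close> satisfies \<open>r ln r \<le> c\<^sup>2\<close>, and the total mass of the reference measure
  is one.\<close>

lemma entropy_S_density_finite:
  assumes [measurable]: "r \<in> borel_measurable borel" and r: "\<And>x. 0 \<le> r x" "\<And>x. r x \<le> c"
  shows "entropy_S (density circle_lebesgue (\<lambda>x. ennreal (r x))) < \<infinity>"
proof -
  let ?\<rho> = "density circle_lebesgue (\<lambda>x. ennreal (r x))"
  define r' where "r' x = enn2real (RN_deriv circle_lebesgue ?\<rho> x)" for x
  have ac: "absolutely_continuous circle_lebesgue ?\<rho>"
    by (intro absolutely_continuousI_density) measurable
  have "AE x in circle_lebesgue. ennreal (r x) = RN_deriv circle_lebesgue ?\<rho> x"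
    by (intro circle_lebesgue.RN_deriv_unique) auto
  then have "AE x in circle_lebesgue. r' x = r x"
    unfolding r'_def by eventually_elim (metis enn2real_ennreal r(1))
  moreover have "r x * ln (r x) \<le> c * c" for x
  proof (cases "r x = 0")
    case False
    then have "r x > 0" using r(1)[of x] by simp
    then have "r x * ln (r x) \<le> r x * r x"
      by (intro mult_left_mono) (auto intro: less_imp_le ln_less_self)
    also have "\<dots> \<le> c * c" using r[of x] by (intro mult_mono) auto
    finally show ?thesis .
  qed simp
  ultimately have "(\<integral>\<^sup>+x. ennreal (r' x * ln (r' x)) \<partial>circle_lebesgue) \<le> (\<integral>\<^sup>+x. ennreal (c * c) \<partial>circle_lebesgue)"
    by (intro nn_integral_mono_AE) (auto elim!: eventually_mono intro!: ennreal_leI)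
  also have "\<dots> = ennreal (c * c)"
    using circle_lebesgue.emeasure_space_1 by simp
  also have "\<dots> < \<top>" by simp
  finally have "enn2ereal (\<integral>\<^sup>+x. ennreal (r' x * ln (r' x)) \<partial>circle_lebesgue) < \<infinity>"
    by (metis enn2ereal_top less_ennreal.rep_eq)
  moreover have "enn2ereal (\<integral>\<^sup>+x. ennreal (r' x * ln (r' x)) \<partial>circle_lebesgue)
      - enn2ereal (\<integral>\<^sup>+x. ennreal (- (r' x * ln (r' x))) \<partial>circle_lebesgue)
      \<le> enn2ereal (\<integral>\<^sup>+x. ennreal (r' x * ln (r' x)) \<partial>circle_lebesgue)"
    using ereal_minus_mono[OF order_refl enn2ereal_nonneg] by fastforce
  moreover have "entropy_S ?\<rho> = enn2ereal (\<integral>\<^sup>+x. ennreal (r' x * ln (r' x)) \<partial>circle_lebesgue)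
      - enn2ereal (\<integral>\<^sup>+x. ennreal (- (r' x * ln (r' x))) \<partial>circle_lebesgue)"
    using ac by (simp add: entropy_S_def r'_def)
  ultimately show ?thesis by (metis le_less_trans)
qed

section \<open>Density of the measures of finite entropy\<close>

text \<open>The representative chosen by \<^term>\<open>rep_circle\<close> is arbitrary; reducing it modulo one gives the
  Borel inverse of \<^term>\<open>abs_circle\<close> on \<open>[0, 1)\<close>.\<close>

definition circle_coord :: "circle \<Rightarrow> real" where
  "circle_coord x = frac (rep_circle x)"

lemma abs_circle_coord: "abs_circle (circle_coord x) = x"
proof -
  have "abs_circle (circle_coord x) = abs_circle (rep_circle x)"
    by (simp add: abs_circle_eq_iff circle_coord_def frac_def)
  then show ?thesis by (simp add: abs_rep_circle)
qed

lemma circle_coord_range: "0 \<le> circle_coord x" "circle_coord x < 1"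
  by (simp_all add: circle_coord_def frac_lt_1)

lemma circle_coord_abs: "circle_coord (abs_circle t) = frac t"
proof -
  have "rep_circle (abs_circle t) - t \<in> \<int>"
    using abs_rep_circle[of "abs_circle t"] by (simp add: abs_circle_eq_iff)
  then obtain n where "rep_circle (abs_circle t) - t = of_int n" by (auto elim: Ints_cases)
  then have "rep_circle (abs_circle t) = t + of_int n" by simp
  then show ?thesis by (simp add: circle_coord_def frac_def)
qed

text \<open>The coordinate is discontinuous at the base point of the circle, but its strict superlevel sets
  are open arcs.\<close>

lemma circle_coord_measurable [measurable]: "circle_coord \<in> borel_measurable borel"
proof (subst borel_measurable_iff_greater, intro allI)
  fix a :: real
  have "open {x. a < circle_coord x}" if "0 \<le> a"
  proof -
    have "{t. a < frac t} = (\<Union>n::int. {of_int n + a <..< of_int n + 1})"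
    proof (intro set_eqI iffI)
      fix t :: real assume "t \<in> {t. a < frac t}"
      then show "t \<in> (\<Union>n::int. {of_int n + a <..< of_int n + 1})"
        by (intro UN_I[of "\<lfloor>t\<rfloor>"]) (auto simp: frac_def)
    next
      fix t :: real assume "t \<in> (\<Union>n::int. {of_int n + a <..< of_int n + 1})"
      then obtain n :: int where n: "of_int n + a < t" "t < of_int n + 1" by auto
      then have "\<lfloor>t\<rfloor> = n" using that by (intro floor_unique) auto
      then show "t \<in> {t. a < frac t}" using n by (simp add: frac_def)
    qed
    then show ?thesis
      by (simp add: open_circle_def vimage_def circle_coord_abs open_UN)
  qed
  moreover have "{x. a < circle_coord x} = UNIV" if "a < 0"
    using circle_coord_range(1) that by (auto intro: less_le_trans)
  ultimately show "{w \<in> space borel. a < circle_coord w} \<in> sets borel"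
    by (cases "0 \<le> a") (auto intro: borel_open)
qed

text \<open>Test functions are Hoelder continuous of order one half, with constant one. With
  \<open>\<bar>\<phi>'\<bar> \<le> l / 2 + \<phi>'\<^sup>2 / (2 l)\<close>, integrating over a distance of at most \<open>1 / l\<^sup>2\<close> costs
  \<open>1 / (2 l)\<close> from each term.\<close>

lemma smooth_circle_holder:
  assumes "smooth_circle \<phi>" "(LINT x|circle_lebesgue. (circle_deriv \<phi> x)\<^sup>2) \<le> 1"
    and "l > 0" and "\<bar>circle_coord x - circle_coord y\<bar> \<le> 1 / l\<^sup>2"
  shows "\<bar>\<phi> x - \<phi> y\<bar> \<le> 1 / l"
proof -
  define g where "g = \<phi> \<circ> abs_circle"
  have cont: "continuous_on A (deriv g)" for A
    unfolding g_def by (rule smooth_circle_deriv(2)[OF assms(1)])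
  have en: "integral {0..1} (\<lambda>t. (deriv g t)\<^sup>2) \<le> 1"
    using assms(2) smooth_circle_energy[OF assms(1)] by (simp add: g_def)
  have ordered: "\<bar>g b - g a\<bar> \<le> 1 / l" if ab: "0 \<le> a" "a \<le> b" "b \<le> 1" "b - a \<le> 1 / l\<^sup>2" for a b
  proof -
    have "(deriv g has_integral (g b - g a)) {a..b}"
      using smooth_circle_deriv(1)[OF assms(1)] ab(2) unfolding g_def
      by (intro fundamental_theorem_of_calculus)
         (auto simp flip: has_real_derivative_iff_has_vector_derivative simp del: o_apply
               intro: has_field_derivative_at_within)
    then have "\<bar>g b - g a\<bar> = norm (integral {a..b} (deriv g))"
      by (simp add: integral_unique)
    also have "\<dots> \<le> integral {a..b} (\<lambda>t. l / 2 + (deriv g t)\<^sup>2 / (2 * l))"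
    proof (rule integral_norm_bound_integral)
      show "norm (deriv g t) \<le> l / 2 + (deriv g t)\<^sup>2 / (2 * l)" for t
        using zero_le_power2[of "\<bar>deriv g t\<bar> - l"] assms(3)
        by (simp add: power2_diff field_simps power2_eq_square)
    qed (use assms(3) in \<open>(intro integrable_continuous_real continuous_intros cont; simp)+\<close>)
    also have "\<dots> = l / 2 * (b - a) + integral {a..b} (\<lambda>t. (deriv g t)\<^sup>2) / (2 * l)"
      using ab assms(3)
      by (subst integral_add)
         (auto intro!: integrable_continuous_real continuous_intros cont)
    also have "integral {a..b} (\<lambda>t. (deriv g t)\<^sup>2) \<le> integral {0..1} (\<lambda>t. (deriv g t)\<^sup>2)"
      using ab by (intro integral_subset_le integrable_continuous_real continuous_intros cont) auto
    then have "l / 2 * (b - a) + integral {a..b} (\<lambda>t. (deriv g t)\<^sup>2) / (2 * l)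
        \<le> l / 2 * (1 / l\<^sup>2) + 1 / (2 * l)"
      using ab en assms(3) by (intro add_mono mult_left_mono divide_right_mono) auto
    also have "\<dots> = 1 / l" using assms(3) by (simp add: field_simps power2_eq_square)
    finally show ?thesis by simp
  qed
  have "\<phi> z = g (circle_coord z)" for z by (simp add: g_def abs_circle_coord)
  then show ?thesis
    using ordered[of "circle_coord x" "circle_coord y"] ordered[of "circle_coord y" "circle_coord x"]
      circle_coord_range[of x] circle_coord_range[of y] assms(4)
    by (cases "circle_coord x \<le> circle_coord y") (auto simp: abs_minus_commute)
qed

text \<open>The circle is cut into \<open>N\<close> half-open arcs of length \<open>1 / N\<close>, numbered from \<open>0\<close>. The number is a
  real so that its measurability is Borel measurability.\<close>

definition arc_index :: "nat \<Rightarrow> circle \<Rightarrow> real" where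
  "arc_index N x = of_int \<lfloor>real N * circle_coord x\<rfloor>"

lemma arc_index_measurable [measurable]: "arc_index N \<in> borel_measurable borel"
  unfolding arc_index_def by measurable

lemma arc_index_eq_dist:
  assumes "arc_index N x = arc_index N y" "N > 0"
  shows "\<bar>circle_coord x - circle_coord y\<bar> \<le> 1 / real N"
proof -
  have "\<lfloor>real N * circle_coord x\<rfloor> = \<lfloor>real N * circle_coord y\<rfloor>"
    using assms(1) by (simp add: arc_index_def)
  then have "\<bar>real N * circle_coord x - real N * circle_coord y\<bar> \<le> 1"
    by linarith
  then have "real N * \<bar>circle_coord x - circle_coord y\<bar> \<le> 1"
    by (simp add: abs_mult flip: right_diff_distrib)
  then show ?thesis using assms(2) by (simp add: field_simps)
qed

lemma measure_arc:
  assumes "N > 0"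
  shows "measure circle_lebesgue {x. arc_index N x = arc_index N y} = 1 / real N"
proof -
  define i where "i = \<lfloor>real N * circle_coord y\<rfloor>"
  have "real N * circle_coord y < real N * 1"
    using circle_coord_range[of y] assms by (intro mult_strict_left_mono) auto
  then have i: "0 \<le> i" "i < int N"
    using circle_coord_range[of y] by (auto simp: i_def floor_less_iff)
  then have i': "0 \<le> real_of_int i" "real_of_int i + 1 \<le> real N" by linarith+
  have "{x. arc_index N x = arc_index N y} \<in> sets borel" by measurable
  then have "emeasure circle_lebesgue {x. arc_index N x = arc_index N y}
      = emeasure lborel (abs_circle -` {x. arc_index N x = arc_index N y} \<inter> {0..<1})"
    by (rule emeasure_circle_lebesgue)
  also have "abs_circle -` {x. arc_index N x = arc_index N y} \<inter> {0..<1}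
      = {of_int i / real N ..< (of_int i + 1) / real N}"
  proof (intro set_eqI iffI)
    fix t assume t: "t \<in> abs_circle -` {x. arc_index N x = arc_index N y} \<inter> {0..<1}"
    then have "frac t = t" by (simp add: frac_eq)
    with t have "\<lfloor>real N * t\<rfloor> = i" by (simp add: arc_index_def circle_coord_abs i_def)
    then show "t \<in> {of_int i / real N ..< (of_int i + 1) / real N}"
      using assms by (auto simp: floor_eq_iff field_simps)
  next
    fix t assume t: "t \<in> {of_int i / real N ..< (of_int i + 1) / real N}"
    have "0 \<le> of_int i / real N" "(of_int i + 1) / real N \<le> 1"
      using i' assms by auto
    with t have t01: "0 \<le> t" "t < 1" by auto
    then have "frac t = t" by (simp add: frac_eq)
    moreover have "\<lfloor>real N * t\<rfloor> = i"
      using t assms by (auto simp: floor_eq_iff field_simps)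
    ultimately show "t \<in> abs_circle -` {x. arc_index N x = arc_index N y} \<inter> {0..<1}"
      using t01 by (simp add: arc_index_def circle_coord_abs i_def)
  qed
  also have "emeasure lborel \<dots> = ennreal (1 / real N)"
    using assms by (simp add: divide_right_mono flip: diff_divide_distrib)
  finally show ?thesis by (simp add: measure_def)
qed

text \<open>For fixed \<open>y\<close> this is the density of the uniform distribution on the arc that contains \<open>y\<close>.\<close>

definition arc_kernel :: "nat \<Rightarrow> circle \<Rightarrow> circle \<Rightarrow> real" where
  "arc_kernel N x y = real N * indicator {x. arc_index N x = arc_index N y} x"

lemma arc_kernel_measurable [measurable (raw)]:
  assumes [measurable]: "f \<in> measurable M borel" "g \<in> measurable M borel"
  shows "(\<lambda>z. arc_kernel N (f z) (g z)) \<in> borel_measurable M"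
  unfolding arc_kernel_def indicator_def by measurable

lemma arc_kernel_bounds: "0 \<le> arc_kernel N x y" "arc_kernel N x y \<le> real N"
  by (auto simp: arc_kernel_def indicator_def)

lemma integral_arc_kernel:
  assumes "N > 0"
  shows "(LINT x|circle_lebesgue. arc_kernel N x y) = 1"
  using measure_arc[OF assms, of y] assms by (simp add: arc_kernel_def)

text \<open>The mass that \<open>p\<close> gives to each arc is spread uniformly over that arc.\<close>

definition arc_average :: "nat \<Rightarrow> circle measure \<Rightarrow> circle measure" where
  "arc_average N p = density circle_lebesgue (\<lambda>x. ennreal (LINT y|p. arc_kernel N x y))"

context
  fixes p :: "circle measure"
  assumes p: "p \<in> PX"
begin

interpretation p: prob_space p
  using p by (simp add: PX_def)

lemma sets_PX [measurable_cong]: "sets p = sets borel"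
  using p by (simp add: PX_def)

interpretation lp: pair_prob_space circle_lebesgue p ..

lemma arc_density_measurable [measurable]:
  "(\<lambda>x. LINT y|p. arc_kernel N x y) \<in> borel_measurable borel"
proof -
  have "(\<lambda>x. LINT y|p. arc_kernel N x y) \<in> borel_measurable circle_lebesgue"
    by measurable
  then show ?thesis by (simp cong: measurable_cong_sets)
qed

lemma arc_density_bounds: "0 \<le> (LINT y|p. arc_kernel N x y)" "(LINT y|p. arc_kernel N x y) \<le> real N"
proof -
  have "integrable p (\<lambda>y. arc_kernel N x y)"
    using arc_kernel_bounds by (intro p.integrable_const_bound[where B = "real N"]) auto
  then show "(LINT y|p. arc_kernel N x y) \<le> real N"
    using arc_kernel_bounds by (intro p.integral_le_const) auto
qed (simp add: arc_kernel_bounds)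

lemma entropy_arc_average: "entropy_S (arc_average N p) < \<infinity>"
  unfolding arc_average_def
  by (rule entropy_S_density_finite[OF arc_density_measurable arc_density_bounds])

lemma integrable_arc_kernel:
  fixes \<phi> :: "circle \<Rightarrow> real"
  assumes [measurable]: "\<phi> \<in> borel_measurable borel" and c: "\<And>x. \<bar>\<phi> x\<bar> \<le> c"
  shows "integrable (circle_lebesgue \<Otimes>\<^sub>M p) (\<lambda>(x, y). arc_kernel N x y * \<phi> x)"
proof (rule lp.P.integrable_const_bound[where B = "real N * c"])
  have "norm (arc_kernel N x y * \<phi> x) \<le> real N * c" for x y
    unfolding norm_mult using arc_kernel_bounds[of N x y] c[of x] by (intro mult_mono) auto
  then show "AE z in circle_lebesgue \<Otimes>\<^sub>M p. norm (case z of (x, y) \<Rightarrow> arc_kernel N x y * \<phi> x) \<le> real N * c"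
    by (intro always_eventually) auto
qed measurable

text \<open>By Fubini's theorem, the average is the mixture under \<open>p\<close> of the uniform distributions on the
  arcs. This form makes it comparable with \<open>p\<close> pointwise in \<open>y\<close>, and for \<open>\<phi> = 1\<close> it gives the
  total mass.\<close>

lemma integral_arc_average:
  fixes \<phi> :: "circle \<Rightarrow> real"
  assumes [measurable]: "\<phi> \<in> borel_measurable borel" and c: "\<And>x. \<bar>\<phi> x\<bar> \<le> c"
  shows "(LINT x|arc_average N p. \<phi> x) = (LINT y|p. LINT x|circle_lebesgue. arc_kernel N x y * \<phi> x)"
proof -
  have "(LINT x|arc_average N p. \<phi> x) = (LINT x|circle_lebesgue. (LINT y|p. arc_kernel N x y) * \<phi> x)"
    unfolding arc_average_def using arc_density_bounds by (subst integral_density) auto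
  also have "\<dots> = (LINT x|circle_lebesgue. LINT y|p. arc_kernel N x y * \<phi> x)"
    by simp
  also have "\<dots> = (LINT y|p. LINT x|circle_lebesgue. arc_kernel N x y * \<phi> x)"
    by (rule lp.Fubini_integral[OF integrable_arc_kernel[OF assms], symmetric])
  finally show ?thesis .
qed

lemma arc_average_PX:
  assumes "N > 0"
  shows "arc_average N p \<in> PX"
proof -
  have "(LINT x|circle_lebesgue. (LINT y|p. arc_kernel N x y)) = (LINT x|arc_average N p. 1)"
    unfolding arc_average_def using arc_density_bounds by (subst integral_density) auto
  also have "\<dots> = 1"
    using integral_arc_average[of "\<lambda>_. 1" 1] p.prob_space by (simp add: integral_arc_kernel[OF assms])
  finally have *: "(LINT x|circle_lebesgue. (LINT y|p. arc_kernel N x y)) = 1" .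
  have "integrable circle_lebesgue (\<lambda>x. LINT y|p. arc_kernel N x y)"
    using arc_density_bounds by (intro circle_lebesgue.integrable_const_bound[where B = "real N"]) auto
  then have "(\<integral>\<^sup>+x. ennreal (LINT y|p. arc_kernel N x y) \<partial>circle_lebesgue) = 1"
    using arc_density_bounds by (subst nn_integral_eq_integral) (auto simp: *)
  then have "prob_space (arc_average N p)"
    unfolding arc_average_def by (intro prob_spaceI) (simp add: emeasure_density)
  then show ?thesis
    by (simp add: PX_def arc_average_def)
qed

text \<open>Averaging moves mass only within arcs of length \<open>1 / l\<^sup>2\<close>, on which a test function varies by
  at most \<open>1 / l\<close>.\<close>

lemma dX_arc_average:
  assumes "l > 0"
  shows "dX p (arc_average (l\<^sup>2) p) \<le> 1 / real l"
proof (rule dX_leI[OF p arc_average_PX])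
  define N where "N = l\<^sup>2"
  have N: "N > 0" "real N = (real l)\<^sup>2" using assms by (auto simp: N_def)
  then show "l\<^sup>2 > 0" by (simp add: N_def)
  fix \<phi> assume \<phi>: "smooth_circle \<phi>" "(LINT x|circle_lebesgue. (circle_deriv \<phi> x)\<^sup>2) \<le> 1"
  define c where "c = \<bar>\<phi> (abs_circle 0)\<bar> + 1"
  have [measurable]: "\<phi> \<in> borel_measurable borel"
    by (intro borel_measurable_continuous_onI smooth_circle_continuous \<phi>)
  have c: "\<bar>\<phi> x\<bar> \<le> c" for x
    using smooth_circle_oscillation[OF \<phi>, of x] by (simp add: c_def)
  have int_p: "integrable p \<phi>"
    using c by (intro p.integrable_const_bound[where B = c]) auto
  have int_K: "integrable circle_lebesgue (\<lambda>x. arc_kernel N x y)" for y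
    using arc_kernel_bounds by (intro circle_lebesgue.integrable_const_bound[where B = "real N"]) auto
  have int_K\<phi>: "integrable circle_lebesgue (\<lambda>x. arc_kernel N x y * \<phi> x)" for y
  proof (rule circle_lebesgue.integrable_const_bound[where B = "real N * c"])
    have "norm (arc_kernel N x y * \<phi> x) \<le> real N * c" for x
      unfolding norm_mult using arc_kernel_bounds[of N x y] c[of x] by (intro mult_mono) auto
    then show "AE x in circle_lebesgue. norm (arc_kernel N x y * \<phi> x) \<le> real N * c"
      by (intro always_eventually) auto
  qed measurable
  have pointwise: "\<phi> y - 1 / real l \<le> (LINT x|circle_lebesgue. arc_kernel N x y * \<phi> x)" for y
  proof -
    have "\<phi> y - 1 / real l = (LINT x|circle_lebesgue. arc_kernel N x y * (\<phi> y - 1 / real l))"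
      by (simp add: integral_arc_kernel[OF N(1)])
    also have "\<dots> \<le> (LINT x|circle_lebesgue. arc_kernel N x y * \<phi> x)"
    proof (intro integral_mono int_K\<phi> integrable_mult_left int_K)
      fix x
      show "arc_kernel N x y * (\<phi> y - 1 / real l) \<le> arc_kernel N x y * \<phi> x"
      proof (cases "arc_index N x = arc_index N y")
        case True
        then have "\<bar>\<phi> x - \<phi> y\<bar> \<le> 1 / real l"
          using arc_index_eq_dist[OF True N(1)] assms N(2)
          by (intro smooth_circle_holder[OF \<phi>]) auto
        then show ?thesis
          by (intro mult_left_mono arc_kernel_bounds) auto
      qed (simp add: arc_kernel_def)
    qed
    finally show ?thesis .
  qed
  have "(LINT y|p. \<phi> y) - 1 / real l = (LINT y|p. \<phi> y - 1 / real l)"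
    using int_p p.prob_space by simp
  also have "\<dots> \<le> (LINT y|p. LINT x|circle_lebesgue. arc_kernel N x y * \<phi> x)"
  proof (intro integral_mono pointwise)
    show "integrable p (\<lambda>y. \<phi> y - 1 / real l)" using int_p by simp
    show "integrable p (\<lambda>y. LINT x|circle_lebesgue. arc_kernel N x y * \<phi> x)"
      using lp.integrable_snd[OF integrable_arc_kernel[where N = N, OF _ c]] by simp
  qed
  also have "\<dots> = (LINT x|arc_average N p. \<phi> x)"
    using integral_arc_average[OF _ c] by simp
  finally show "measure_diff p (arc_average (l\<^sup>2) p) \<phi> \<le> 1 / real l"
    by (simp add: measure_diff_def N_def)
qed

end

lemma finite_entropy_dense:
  assumes "p \<in> PX" "e > 0"
  shows "\<exists>\<rho>\<in>PX. entropy_S \<rho> < \<infinity> \<and> dX p \<rho> < e"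
proof -
  obtain l where l: "l > 0" "1 / real l < e"
    using reals_Archimedean[OF assms(2)] by (metis inverse_eq_divide zero_less_Suc)
  then have "dX p (arc_average (l\<^sup>2) p) < e"
    using dX_arc_average[OF assms(1) l(1)] by linarith
  then show ?thesis
    using arc_average_PX[OF assms(1), of "l\<^sup>2"] entropy_arc_average[OF assms(1), of "l\<^sup>2"] l(1) by auto
qed

section \<open>The viscosity inequalities in real form\<close>

lemma entropy_S_real:
  assumes "entropy_S \<rho> < \<infinity>"
  obtains s where "entropy_S \<rho> = ereal s"
  using assms entropy_S_ge[of \<rho>] by (cases "entropy_S \<rho>") auto

text \<open>The left-hand side of the viscosity inequality is finite, hence so is the right-hand side: the
  maximizer has finite entropy automatically. This is what keeps the comparison argument inside
  the domain of the entropy.\<close>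

lemma subsolution_maximizer:
  assumes sub: "viscosity_subsolution H0 \<alpha> h u"
    and "k > 0" and \<gamma>: "\<gamma> \<in> PX" "entropy_S \<gamma> < \<infinity>"
  shows "\<exists>\<rho>\<in>PX. entropy_S \<rho> < \<infinity> \<and>
    (\<forall>x\<in>PX. u x - k / 2 * (dX x \<gamma>)\<^sup>2 \<le> u \<rho> - k / 2 * (dX \<rho> \<gamma>)\<^sup>2) \<and>
    inverse \<alpha> * (u \<rho> - h \<rho>)
      \<le> k / 2 * (real_of_ereal (entropy_S \<gamma>) - real_of_ereal (entropy_S \<rho>)) + k\<^sup>2 / 2 * (dX \<rho> \<gamma>)\<^sup>2"
proof -
  have "(\<lambda>\<rho>. k / 2 * (dX \<rho> \<gamma>)\<^sup>2,
      \<lambda>\<rho>. ereal (k / 2) * (entropy_S \<gamma> - entropy_S \<rho>) + ereal (k\<^sup>2 / 2) * (hm1_norm (measure_diff \<rho> \<gamma>))\<^sup>2) \<in> H0"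
    unfolding H0_def using assms(2-4) by blast
  then obtain \<rho> where \<rho>: "\<rho> \<in> PX"
    and max: "ereal (u \<rho> - k / 2 * (dX \<rho> \<gamma>)\<^sup>2) = (SUP x\<in>PX. ereal (u x - k / 2 * (dX x \<gamma>)\<^sup>2))"
    and ineq: "ereal (inverse \<alpha> * (u \<rho> - h \<rho>))
      \<le> ereal (k / 2) * (entropy_S \<gamma> - entropy_S \<rho>) + ereal (k\<^sup>2 / 2) * (hm1_norm (measure_diff \<rho> \<gamma>))\<^sup>2"
    using sub unfolding viscosity_subsolution_def by fastforce
  obtain g where g: "entropy_S \<gamma> = ereal g" using entropy_S_real[OF \<gamma>(2)] .
  have fin: "entropy_S \<rho> < \<infinity>"
  proof (rule ccontr)
    assume "\<not> entropy_S \<rho> < \<infinity>"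
    then have "entropy_S \<rho> = \<infinity>" by simp
    then show False
      using ineq \<open>k > 0\<close> unfolding ereal_dX[OF \<rho> \<gamma>(1), symmetric] by (simp add: g)
  qed
  obtain r where r: "entropy_S \<rho> = ereal r" using entropy_S_real[OF fin] .
  have "u x - k / 2 * (dX x \<gamma>)\<^sup>2 \<le> u \<rho> - k / 2 * (dX \<rho> \<gamma>)\<^sup>2" if "x \<in> PX" for x
  proof -
    have "ereal (u x - k / 2 * (dX x \<gamma>)\<^sup>2) \<le> ereal (u \<rho> - k / 2 * (dX \<rho> \<gamma>)\<^sup>2)"
      unfolding max using that by (rule SUP_upper)
    then show ?thesis by simp
  qed
  moreover have "inverse \<alpha> * (u \<rho> - h \<rho>) \<le> k / 2 * (g - r) + k\<^sup>2 / 2 * (dX \<rho> \<gamma>)\<^sup>2"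
    using ineq unfolding ereal_dX[OF \<rho> \<gamma>(1), symmetric] by (simp add: g r)
  ultimately show ?thesis using \<rho> by (intro bexI[of _ \<rho>] conjI ballI) (auto simp: g r)
qed

lemma supersolution_minimizer:
  assumes super: "viscosity_supersolution H1 \<alpha> h v"
    and "k > 0" and \<rho>: "\<rho> \<in> PX" "entropy_S \<rho> < \<infinity>"
  shows "\<exists>\<gamma>\<in>PX. entropy_S \<gamma> < \<infinity> \<and>
    (\<forall>x\<in>PX. v \<gamma> + k / 2 * (dX \<rho> \<gamma>)\<^sup>2 \<le> v x + k / 2 * (dX \<rho> x)\<^sup>2) \<and>
    k / 2 * (real_of_ereal (entropy_S \<gamma>) - real_of_ereal (entropy_S \<rho>)) + k\<^sup>2 / 2 * (dX \<rho> \<gamma>)\<^sup>2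
      \<le> inverse \<alpha> * (v \<gamma> - h \<gamma>)"
proof -
  have "(\<lambda>\<gamma>. - (k / 2) * (dX \<rho> \<gamma>)\<^sup>2,
      \<lambda>\<gamma>. ereal (k / 2) * (entropy_S \<gamma> - entropy_S \<rho>) + ereal (k\<^sup>2 / 2) * (hm1_norm (measure_diff \<rho> \<gamma>))\<^sup>2) \<in> H1"
    unfolding H1_def using assms(2-4) by blast
  then obtain \<gamma> where \<gamma>: "\<gamma> \<in> PX"
    and max: "ereal (- (k / 2) * (dX \<rho> \<gamma>)\<^sup>2 - v \<gamma>) = (SUP x\<in>PX. ereal (- (k / 2) * (dX \<rho> x)\<^sup>2 - v x))"
    and ineq: "ereal (k / 2) * (entropy_S \<gamma> - entropy_S \<rho>) + ereal (k\<^sup>2 / 2) * (hm1_norm (measure_diff \<rho> \<gamma>))\<^sup>2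
      \<le> ereal (inverse \<alpha> * (v \<gamma> - h \<gamma>))"
    using super unfolding viscosity_supersolution_def by fastforce
  obtain r where r: "entropy_S \<rho> = ereal r" using entropy_S_real[OF \<rho>(2)] .
  have fin: "entropy_S \<gamma> < \<infinity>"
  proof (rule ccontr)
    assume "\<not> entropy_S \<gamma> < \<infinity>"
    then have "entropy_S \<gamma> = \<infinity>" by simp
    then show False
      using ineq \<open>k > 0\<close> unfolding ereal_dX[OF \<rho>(1) \<gamma>, symmetric] by (simp add: r)
  qed
  obtain g where g: "entropy_S \<gamma> = ereal g" using entropy_S_real[OF fin] .
  have "v \<gamma> + k / 2 * (dX \<rho> \<gamma>)\<^sup>2 \<le> v x + k / 2 * (dX \<rho> x)\<^sup>2" if "x \<in> PX" for x
  proof -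
    have "ereal (- (k / 2) * (dX \<rho> x)\<^sup>2 - v x) \<le> ereal (- (k / 2) * (dX \<rho> \<gamma>)\<^sup>2 - v \<gamma>)"
      unfolding max using that by (rule SUP_upper)
    then show ?thesis by simp
  qed
  moreover have "k / 2 * (g - r) + k\<^sup>2 / 2 * (dX \<rho> \<gamma>)\<^sup>2 \<le> inverse \<alpha> * (v \<gamma> - h \<gamma>)"
    using ineq unfolding ereal_dX[OF \<rho>(1) \<gamma>, symmetric] by (simp add: g r)
  ultimately show ?thesis using \<gamma> by (intro bexI[of _ \<gamma>] conjI ballI) (auto simp: g r)
qed

section \<open>The comparison principle\<close>

theorem theorem2p1:
  fixes h\<^sub>0 h\<^sub>1 f_sub f_super :: "circle measure \<Rightarrow> real" and \<alpha> :: real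
  assumes "h\<^sub>0 \<in> UC_b" and "h\<^sub>1 \<in> UC_b" and "\<alpha> > 0"
    and "bounded (f_sub ` PX)" and "usc_X f_sub"
    and "viscosity_subsolution H0 \<alpha> h\<^sub>0 f_sub"
    and "bounded (f_super ` PX)" and "lsc_X f_super"
    and "viscosity_supersolution H1 \<alpha> h\<^sub>1 f_super"
  shows "(SUP \<rho>\<in>PX. ereal (f_sub \<rho> - f_super \<rho>)) \<le> (SUP \<rho>\<in>PX. ereal (h\<^sub>0 \<rho> - h\<^sub>1 \<rho>))"
proof (rule SUP_least)
  fix p assume p: "p \<in> PX"
  obtain B\<^sub>0 B\<^sub>1 where B: "\<And>x. x \<in> PX \<Longrightarrow> \<bar>f_sub x\<bar> \<le> B\<^sub>0" "\<And>x. x \<in> PX \<Longrightarrow> \<bar>f_super x\<bar> \<le> B\<^sub>1"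
    using assms(4,7) unfolding bounded_iff by auto
  have pointwise: "f_sub p - f_super p \<le> C" if C: "\<And>x. x \<in> PX \<Longrightarrow> h\<^sub>0 x - h\<^sub>1 x \<le> C" for C
  proof (rule comparison_by_near_minimal_potential[where X = PX and F = "{\<rho> \<in> PX. entropy_S \<rho> < \<infinity>}" and d = dX
        and s = "\<lambda>\<rho>. real_of_ereal (entropy_S \<rho>)" and b = "- 1" and B = "max B\<^sub>0 B\<^sub>1"
        and u = f_sub and v = f_super and h\<^sub>0 = h\<^sub>0 and h\<^sub>1 = h\<^sub>1 and \<alpha> = \<alpha>])
    fix x assume "x \<in> {\<rho> \<in> PX. entropy_S \<rho> < \<infinity>}"
    then obtain s where s: "entropy_S x = ereal s" using entropy_S_real by auto
    then show "- 1 \<le> real_of_ereal (entropy_S x)"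
      using entropy_S_ge[of x] by (simp add: one_ereal_def)
  next
    fix e :: real assume "e > 0"
    then show "\<exists>\<delta>>0. \<forall>x\<in>PX. \<forall>y\<in>PX. dX x y < \<delta> \<longrightarrow> \<bar>h\<^sub>1 x - h\<^sub>1 y\<bar> < e"
      using assms(2) by (simp add: UC_b_def)
  next
    fix k :: real and \<gamma> assume "k > 0" "\<gamma> \<in> {\<rho> \<in> PX. entropy_S \<rho> < \<infinity>}"
    then show "\<exists>\<rho>\<in>{\<rho> \<in> PX. entropy_S \<rho> < \<infinity>}.
        (\<forall>x\<in>PX. f_sub x - k / 2 * (dX x \<gamma>)\<^sup>2 \<le> f_sub \<rho> - k / 2 * (dX \<rho> \<gamma>)\<^sup>2) \<and>
        inverse \<alpha> * (f_sub \<rho> - h\<^sub>0 \<rho>)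
          \<le> k / 2 * (real_of_ereal (entropy_S \<gamma>) - real_of_ereal (entropy_S \<rho>)) + k\<^sup>2 / 2 * (dX \<rho> \<gamma>)\<^sup>2"
      using subsolution_maximizer[OF assms(6), of k \<gamma>] by auto
  next
    fix k :: real and \<rho> assume "k > 0" "\<rho> \<in> {\<rho> \<in> PX. entropy_S \<rho> < \<infinity>}"
    then show "\<exists>\<gamma>\<in>{\<rho> \<in> PX. entropy_S \<rho> < \<infinity>}.
        (\<forall>x\<in>PX. f_super \<gamma> + k / 2 * (dX \<rho> \<gamma>)\<^sup>2 \<le> f_super x + k / 2 * (dX \<rho> x)\<^sup>2) \<and>
        k / 2 * (real_of_ereal (entropy_S \<gamma>) - real_of_ereal (entropy_S \<rho>)) + k\<^sup>2 / 2 * (dX \<rho> \<gamma>)\<^sup>2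
          \<le> inverse \<alpha> * (f_super \<gamma> - h\<^sub>1 \<gamma>)"
      using supersolution_minimizer[OF assms(9), of k \<rho>] by auto
  next
    fix x and e :: real assume "x \<in> PX" "e > 0"
    then show "\<exists>y\<in>{\<rho> \<in> PX. entropy_S \<rho> < \<infinity>}. dX x y < e"
      using finite_entropy_dense[of x e] by auto
  qed (use assms(3) p B C dX_nonneg dX_commute dX_triangle in \<open>auto intro: le_max_iff_disj[THEN iffD2]\<close>)
  let ?C = "SUP \<rho>\<in>PX. ereal (h\<^sub>0 \<rho> - h\<^sub>1 \<rho>)"
  have up: "ereal (h\<^sub>0 x - h\<^sub>1 x) \<le> ?C" if "x \<in> PX" for x
    using that by (rule SUP_upper)
  show "ereal (f_sub p - f_super p) \<le> ?C"
  proof (cases ?C)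
    case (real C)
    then show ?thesis using pointwise[of C] up by simp
  next
    case MInf
    then show ?thesis using up[OF p] by simp
  qed simp
qed

end
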